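(* Let $p>0$ and $\Delta\ge 3$ be integers, and let $G=(V,E)$ be a finite graph with maximum degree $\Delta(G)\le\Delta$. Then \[ {\rm mad}(G^{p})\le \frac{\Delta}{\Delta-2}\cdot 2\left\lfloor\frac{p+1}{2}\right\rfloor\cdot {\rm wcol}_{\lceil p/2\rceil}(G)\cdot(\Delta-1)^{\lfloor p/2\rfloor}. \]
   Context: For a graph $G$, ${\rm dist}_G(x,y)$ is the length of a shortest $x,y$-path. The $p$-th power of $G=(V,E)$ is the graph $G^{p}=(V,E^{p})$ with $E^{p}=\{xy: 1\le {\rm dist}_{G}(x,y)\le p\}$. The maximum average degree is ${\rm mad}(H)=\max_{\emptyset\ne H'\subseteq H}\frac{2\|H'\|}{|H'|}$ (number of edges over number of vertices). For a total ordering $\sigma$ of $V$ and $x\in V$, let $V^{l}_\sigma[x]=\{y: y<_\sigma x\}\cup\{x\}$ and $V^{r}_\sigma[y]=\{z: y<_\sigma z\}\cup\{y\}$. A vertex $y$ is weakly $k$-reachable from $x$ with respect to $\sigma$ if $y\in V^{l}_\sigma[x]$ and there is an $x,y$-path $P$ in $G$ with at most $k$ edges and $V(P)\subseteq V^{r}_\sigma[y]$. Let $W^{k}_\sigma[x]$ be the set of vertices weakly $k$-reachable from $x$. The weak $k$-coloring number is ${\rm wcol}_k(G)=\min_{\sigma}\max_{x\in V}|W^{k}_\sigma[x]|$, the minimum over all total orderings $\sigma$ of $V$. *)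

theory Defs
  imports Complex_Main "HOL-Library.Extended_Nat" "Graph_Theory.Graph_Theory"
begin

text \<open>
  A finite simple graph is a \<^const>\<open>pair_graph\<close>: an undirected edge between \<open>x\<close> and \<open>y\<close> is
  represented by the two arcs \<open>(x, y)\<close> and \<open>(y, x)\<close>, so the out-degree of a vertex is its degree.
\<close>

definition uedges :: "'a pair_pre_digraph \<Rightarrow> 'a set set" where
  "uedges G = {{x, y} | x y. (x, y) \<in> parcs G}"

text \<open>On the graph without vertices, the maxima below are over the empty set and are read as 0.\<close>

definition max_degree :: "'a pair_pre_digraph \<Rightarrow> nat" where
  "max_degree G = (if pverts G = {} then 0 else (MAX x\<in>pverts G. out_degree (with_proj G) x))"

definition path_betw :: "'a pair_pre_digraph \<Rightarrow> 'a \<Rightarrow> 'a list \<Rightarrow> 'a \<Rightarrow> bool" where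
  "path_betw G x P y \<longleftrightarrow> vpath P (with_proj G) \<and> hd P = x \<and> last P = y"

text \<open>The distance is \<open>\<infinity>\<close> (the infimum of the empty set) if there is no path.\<close>

definition gdist :: "'a pair_pre_digraph \<Rightarrow> 'a \<Rightarrow> 'a \<Rightarrow> enat" where
  "gdist G x y = (INF P\<in>{P. path_betw G x P y}. enat (vwalk_length P))"

definition gpower :: "'a pair_pre_digraph \<Rightarrow> nat \<Rightarrow> 'a pair_pre_digraph" where
  "gpower G p = \<lparr> pverts = pverts G,
     parcs = {(x, y) \<in> pverts G \<times> pverts G. 1 \<le> gdist G x y \<and> gdist G x y \<le> enat p} \<rparr>"

definition nonempty_subgraphs :: "'a pair_pre_digraph \<Rightarrow> 'a pair_pre_digraph set" where
  "nonempty_subgraphs H =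
     {H'. pair_graph H' \<and> subgraph (with_proj H') (with_proj H) \<and> pverts H' \<noteq> {}}"

definition mad :: "'a pair_pre_digraph \<Rightarrow> real" where
  "mad H = (if pverts H = {} then 0
     else (MAX H'\<in>nonempty_subgraphs H. 2 * real (card (uedges H')) / real (card (pverts H'))))"

text \<open>
  A total ordering of the vertex set is a reflexive relation \<open>\<sigma>\<close> with
  \<^term>\<open>linear_order_on (pverts G) \<sigma>\<close>; the pair \<open>(y, x)\<close> is in \<open>\<sigma>\<close> if \<open>y\<close> is \<open>x\<close> or precedes \<open>x\<close>.
\<close>

definition left_closed :: "'a rel \<Rightarrow> 'a \<Rightarrow> 'a set" where
  "left_closed \<sigma> x = {y. (y, x) \<in> \<sigma> \<and> y \<noteq> x} \<union> {x}"

definition right_closed :: "'a rel \<Rightarrow> 'a \<Rightarrow> 'a set" where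
  "right_closed \<sigma> y = {z. (y, z) \<in> \<sigma> \<and> y \<noteq> z} \<union> {y}"

definition weakly_reachable :: "'a pair_pre_digraph \<Rightarrow> 'a rel \<Rightarrow> nat \<Rightarrow> 'a \<Rightarrow> 'a \<Rightarrow> bool" where
  "weakly_reachable G \<sigma> k x y \<longleftrightarrow> y \<in> left_closed \<sigma> x \<and>
     (\<exists>P. path_betw G x P y \<and> vwalk_length P \<le> k \<and> set P \<subseteq> right_closed \<sigma> y)"

definition wreach_set :: "'a pair_pre_digraph \<Rightarrow> 'a rel \<Rightarrow> nat \<Rightarrow> 'a \<Rightarrow> 'a set" where
  "wreach_set G \<sigma> k x = {y. weakly_reachable G \<sigma> k x y}"

definition wcol :: "nat \<Rightarrow> 'a pair_pre_digraph \<Rightarrow> nat" where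
  "wcol k G = (if pverts G = {} then 0
     else (MIN \<sigma>\<in>{\<sigma>. linear_order_on (pverts G) \<sigma>}. MAX x\<in>pverts G. card (wreach_set G \<sigma> k x)))"

text \<open>The power of a graph is a graph, and all extrema above are over finite nonempty sets.\<close>

lemma path_betw_rev:
  assumes "pair_graph G" "path_betw G x P y"
  shows "path_betw G y (rev P) x"
proof -
  have s: "sym (parcs G)"
    using assms(1) by (auto simp: pair_graph_def pair_pseudo_graph_def pair_sym_digraph_def
        pair_sym_digraph_axioms_def symmetric_def)
  have app: "set (vwalk_arcs (xs @ [a])) = set (vwalk_arcs xs) \<union> (if xs = [] then {} else {(last xs, a)})"
    for xs :: "'a list" and a
    by (induction xs rule: vwalk_arcs.induct) auto
  have "set (vwalk_arcs (rev P)) = (set (vwalk_arcs P))\<inverse>"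
  proof (induction P rule: vwalk_arcs.induct)
    case (3 x y xs)
    then show ?case using app[of "rev (y # xs)" x] by auto
  qed auto
  then show ?thesis
    using assms(2) s by (auto simp: path_betw_def vpath_def vwalk_def hd_rev last_rev sym_def)
qed

lemma gdist_commute:
  assumes "pair_graph G"
  shows "gdist G x y = gdist G y x"
proof -
  have "gdist G u v \<le> gdist G v u" for u v
    unfolding gdist_def
    by (rule INF_mono) (use path_betw_rev[OF assms] in \<open>auto intro!: exI[of _ "rev _"]\<close>)
  then show ?thesis by (simp add: antisym)
qed

lemma gdist_self:
  assumes "x \<in> pverts G"
  shows "gdist G x x = 0"
proof -
  have "path_betw G x [x] x"
    using assms by (auto simp: path_betw_def vpath_def vwalk_def)
  then have "gdist G x x \<le> enat (vwalk_length [x])"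
    unfolding gdist_def by (intro INF_lower) simp
  then show ?thesis by (simp add: zero_enat_def[symmetric])
qed

lemma pair_graph_gpower:
  assumes "pair_graph G"
  shows "pair_graph (gpower G p)"
proof -
  interpret pair_graph G by fact
  show ?thesis
  proof unfold_locales
    show "finite (parcs (gpower G p))"
      by (rule finite_subset[of _ "pverts G \<times> pverts G"]) (auto simp: gpower_def)
    show "symmetric (with_proj (gpower G p))"
      using gdist_commute[OF assms] by (auto simp: symmetric_def gpower_def sym_def)
    show "fst e \<noteq> snd e" if "e \<in> parcs (gpower G p)" for e
      using that gdist_self[of "fst e" G] by (auto simp: gpower_def)
  qed (auto simp: gpower_def)
qed

lemma finite_nonempty_subgraphs:
  assumes "pair_graph H"
  shows "finite (nonempty_subgraphs H)"
proof -
  interpret pair_graph H by fact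
  have "nonempty_subgraphs H \<subseteq> (\<lambda>(V, A). \<lparr> pverts = V, parcs = A \<rparr>) ` (Pow (pverts H) \<times> Pow (parcs H))"
  proof
    fix H' assume "H' \<in> nonempty_subgraphs H"
    then have "(pverts H', parcs H') \<in> Pow (pverts H) \<times> Pow (parcs H)"
      by (auto simp: nonempty_subgraphs_def subgraph_def)
    then show "H' \<in> (\<lambda>(V, A). \<lparr> pverts = V, parcs = A \<rparr>) ` (Pow (pverts H) \<times> Pow (parcs H))"
      by (rule rev_image_eqI) simp
  qed
  then show ?thesis
    by (rule finite_subset) (simp add: pair_finite_verts pair_finite_arcs)
qed

lemma nonempty_subgraphs_self:
  assumes "pair_graph H" "pverts H \<noteq> {}"
  shows "H \<in> nonempty_subgraphs H"
proof -
  interpret pair_graph H by fact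
  show ?thesis
    using assms wf_digraph_axioms by (auto simp: nonempty_subgraphs_def subgraph_def compatible_def)
qed

lemma finite_linear_orders:
  assumes "finite A"
  shows "finite {\<sigma>. linear_order_on A \<sigma>}"
  by (rule finite_subset[of _ "Pow (A \<times> A)"])
    (use assms in \<open>auto simp: linear_order_on_def partial_order_on_def preorder_on_def\<close>)

lemma linear_orders_nonempty: "{\<sigma>. linear_order_on A \<sigma>} \<noteq> {}"
  using well_order_on[of A] by (auto simp: well_order_on_def)

lemma wreach_set_subset: "wreach_set G \<sigma> k x \<subseteq> pverts G"
  by (auto simp: wreach_set_def weakly_reachable_def path_betw_def vpath_def vwalk_def)

end

theory Submission
  imports Defs
begin

text \<open>
  Write \<open>q = \<lceil>p/2\<rceil>\<close> and \<open>r = \<lfloor>p/2\<rfloor>\<close>, fix an ordering that attains the weak \<open>q\<close>-coloring number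
  \<open>c\<close>, and let \<open>S\<close> be the vertex set of a subgraph of the power. Take an ordered pair \<open>(x, y)\<close> of
  its adjacent vertices, joined in \<open>G\<close> by a path of length \<open>L \<le> p\<close>. If \<open>L \<ge> r\<close>, let \<open>z\<close> be the least
  vertex of the path (without \<open>y\<close> if \<open>p\<close> is even), at position \<open>i\<close>. If \<open>i < q\<close>, then \<open>z\<close> is weakly
  \<open>q\<close>-reachable from the path vertex \<open>w\<close> at \<open>r - i\<close> steps from \<open>y\<close>, so \<open>y\<close> determines \<open>x\<close> up to the
  choice of a path of length \<open>r - i\<close> to \<open>w\<close>, of one of \<open>c\<close> vertices \<open>z\<close>, and of a path of length
  \<open>i\<close> to \<open>x\<close>. If \<open>i \<ge> q\<close>, the same holds with \<open>x\<close> and \<open>y\<close> exchanged. Each of these \<open>2 * q\<close> cases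
  contributes at most \<open>\<Delta>/(\<Delta> - 2) * c * (\<Delta> - 1)^r\<close> pairs per vertex of \<open>S\<close>, and the case \<open>i = 0\<close>
  leaves enough room for the pairs with \<open>L < r\<close>.
\<close>

section \<open>Paths with a given number of edges\<close>

definition paths_from :: "'a pair_pre_digraph \<Rightarrow> nat \<Rightarrow> 'a \<Rightarrow> 'a list set" where
  "paths_from G k v = {P. vpath P (with_proj G) \<and> hd P = v \<and> length P = Suc k}"

text \<open>The paths need not be shortest, so this is not a sphere in the metric of
  \<open>G\<close>. The counting works with arbitrary paths throughout.\<close>

definition path_ends :: "'a pair_pre_digraph \<Rightarrow> nat \<Rightarrow> 'a \<Rightarrow> 'a set" where
  "path_ends G k v = {u. \<exists>P. path_betw G v P u \<and> length P = Suc k}"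

text \<open>The size of the sphere of radius \<open>k\<close> in the infinite
  \<open>\<Delta>\<close>-regular tree.\<close>

definition path_count :: "nat \<Rightarrow> nat \<Rightarrow> nat" where
  "path_count \<Delta> k = (if k = 0 then 1 else \<Delta> * (\<Delta> - 1) ^ (k - 1))"

lemma card_UN_bounded:
  assumes "finite A" and "card A \<le> m" and "\<And>x. x \<in> A \<Longrightarrow> card (B x) \<le> n"
  shows "card (\<Union>x\<in>A. B x) \<le> m * n"
proof -
  have "card (\<Union>x\<in>A. B x) \<le> (\<Sum>x\<in>A. card (B x))"
    using assms(1) by (rule card_UN_le)
  also have "\<dots> \<le> card A * n"
    using sum_bounded_above[of A "\<lambda>x. card (B x)" n] assms(3) by simp
  also have "\<dots> \<le> m * n" using assms(2) by simp
  finally show ?thesis .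
qed

lemma card_Sigma_bounded:
  assumes "finite A" and "card A \<le> m" and "\<And>x. x \<in> A \<Longrightarrow> finite (B x)"
    and "\<And>x. x \<in> A \<Longrightarrow> card (B x) \<le> n"
  shows "card (Sigma A B) \<le> m * n"
proof -
  have "Sigma A B = (\<Union>x\<in>A. Pair x ` B x)" by auto
  moreover have "card (Pair x ` B x) \<le> n" if "x \<in> A" for x
    using assms(3,4)[OF that] card_image_le[of "B x" "Pair x"] by simp
  ultimately show ?thesis
    using card_UN_bounded[OF assms(1,2), of "\<lambda>x. Pair x ` B x" n] by simp
qed

lemma path_ends_eq: "path_ends G k v = last ` paths_from G k v"
  by (auto simp: path_ends_def paths_from_def path_betw_def image_iff)

lemma path_ends_subset: "path_ends G k v \<subseteq> pverts G"
  by (auto simp: path_ends_def path_betw_def vpath_def vwalk_def)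

lemma finite_paths_from:
  assumes "pair_graph G"
  shows "finite (paths_from G k v)"
proof -
  interpret pair_graph G by fact
  have "paths_from G k v \<subseteq> {P. set P \<subseteq> pverts G \<and> length P = Suc k}"
    by (auto simp: paths_from_def vpath_def vwalk_def)
  then show ?thesis
    using finite_lists_length_eq[OF pair_finite_verts, of "Suc k"] by (rule finite_subset)
qed

lemma path_ends_commute:
  assumes "pair_graph G"
  shows "u \<in> path_ends G k v \<longleftrightarrow> v \<in> path_ends G k u"
  using path_betw_rev[OF assms] by (fastforce simp: path_ends_def)

lemma vwalk_snoc:
  assumes "Q \<noteq> []"
  shows "vwalk (Q @ [a]) (with_proj G) \<longleftrightarrow>
    vwalk Q (with_proj G) \<and> a \<in> pverts G \<and> (last Q, a) \<in> parcs G"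
  using assms by (auto simp: vwalk_def vwalk_arcs_append)

lemma card_neighbours:
  assumes "pair_graph G" "max_degree G \<le> \<Delta>" "x \<in> pverts G"
  shows "card {y. (x, y) \<in> parcs G} \<le> \<Delta>"
proof -
  interpret pair_graph G by fact
  have "out_arcs (with_proj G) x = Pair x ` {y. (x, y) \<in> parcs G}" by auto
  then have "card {y. (x, y) \<in> parcs G} = out_degree (with_proj G) x"
    by (simp add: out_degree_def card_image inj_on_def)
  also have "\<dots> \<le> max_degree G"
    using assms(3) by (auto simp: max_degree_def intro!: Max_ge)
  finally show ?thesis using assms(2) by simp
qed

text \<open>A longer path arises by appending a neighbour of the last vertex. From the second step
  on, the previous vertex is a neighbour that may not be revisited, so at most
  \<open>\<Delta> - 1\<close> choices remain.\<close>

lemma card_paths_from: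
  assumes "pair_graph G" "max_degree G \<le> \<Delta>"
  shows "card (paths_from G k v) \<le> path_count \<Delta> k"
proof (induction k)
  case 0
  have "paths_from G 0 v \<subseteq> {[v]}"
    by (auto simp: paths_from_def length_Suc_conv)
  then show ?case
    using card_mono[of "{[v]}"] by (simp add: path_count_def)
next
  case (Suc k)
  interpret pair_graph G by fact
  define ext where "ext Q = {a. (last Q, a) \<in> parcs G \<and> a \<notin> set Q}" for Q
  define m where "m = (if k = 0 then \<Delta> else \<Delta> - 1)"
  have fin: "finite {a. (x, a) \<in> parcs G}" for x
    using finite_imageI[OF pair_finite_arcs, of snd] by (rule rev_finite_subset) force
  have "paths_from G (Suc k) v \<subseteq> (\<lambda>(Q, a). Q @ [a]) ` Sigma (paths_from G k v) ext"
  proof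
    fix P assume P: "P \<in> paths_from G (Suc k) v"
    then obtain Q a where Q: "P = Q @ [a]" "length Q = Suc k"
      by (cases P rule: rev_cases) (auto simp: paths_from_def)
    then have "Q \<noteq> []" by auto
    then have "Q \<in> paths_from G k v" "a \<in> ext Q"
      using P Q by (auto simp: paths_from_def vpath_def vwalk_snoc ext_def)
    then show "P \<in> (\<lambda>(Q, a). Q @ [a]) ` Sigma (paths_from G k v) ext"
      using Q by force
  qed
  moreover have finext: "finite (ext Q)" for Q
    using fin[of "last Q"] by (rule rev_finite_subset) (auto simp: ext_def)
  ultimately have "card (paths_from G (Suc k) v) \<le> card (Sigma (paths_from G k v) ext)"
    using finite_paths_from[OF assms(1)] by (intro surj_card_le) auto
  also have "\<dots> \<le> path_count \<Delta> k * m"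
  proof (rule card_Sigma_bounded[OF finite_paths_from[OF assms(1)] Suc.IH])
    fix Q assume Q: "Q \<in> paths_from G k v"
    then have ne: "Q \<noteq> []" and last: "last Q \<in> pverts G"
      by (auto simp: paths_from_def vpath_def vwalk_def)
    have nb: "card {a. (last Q, a) \<in> parcs G} \<le> \<Delta>"
      using card_neighbours[OF assms last] .
    show "card (ext Q) \<le> m"
    proof (cases "k = 0")
      case True
      have "card (ext Q) \<le> card {a. (last Q, a) \<in> parcs G}"
        by (rule card_mono[OF fin]) (auto simp: ext_def)
      then show ?thesis using nb True by (simp add: m_def)
    next
      case False
      obtain R b where R: "Q = R @ [b]" "R \<noteq> []"
        using Q False ne by (cases Q rule: rev_cases) (auto simp: paths_from_def)
      then have "(last R, b) \<in> parcs G"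
        using Q by (auto simp: paths_from_def vpath_def vwalk_snoc)
      then have "(last Q, last R) \<in> parcs G"
        using sym_arcs R by (auto simp: symmetric_def sym_def)
      moreover have "ext Q \<subseteq> {a. (last Q, a) \<in> parcs G} - {last R}"
        using R by (auto simp: ext_def)
      ultimately have "card (ext Q) \<le> card {a. (last Q, a) \<in> parcs G} - 1"
        using card_mono[OF _ \<open>ext Q \<subseteq> _\<close>] fin[of "last Q"] by simp
      then show ?thesis using nb False by (simp add: m_def)
    qed
  qed (use finext in auto)
  also have "path_count \<Delta> k * m = path_count \<Delta> (Suc k)"
    by (cases k) (auto simp: path_count_def m_def)
  finally show ?case .
qed

lemma card_path_ends:
  assumes "pair_graph G" "max_degree G \<le> \<Delta>"
  shows "card (path_ends G k v) \<le> path_count \<Delta> k"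
  unfolding path_ends_eq
  using card_image_le[OF finite_paths_from[OF assms(1)]] card_paths_from[OF assms] le_trans by blast

section \<open>Segments of a path and weak reachability\<close>

lemma subpath:
  assumes "vpath P (with_proj G)" and "a \<le> b" and "b < length P"
  defines "Q \<equiv> take (Suc (b - a)) (drop a P)"
  shows "path_betw G (P ! a) Q (P ! b)" and "length Q = Suc (b - a)"
    and "set Q = (!) P ` {a..b}"
proof -
  show len: "length Q = Suc (b - a)" using assms by simp
  then have ne: "Q \<noteq> []" by auto
  have P: "P = take a P @ Q @ drop (Suc (b - a)) (drop a P)" (is "_ = ?A @ Q @ ?B")
    unfolding Q_def by (metis append_take_drop_id)
  have app: "set (vwalk_arcs xs) \<subseteq> set (vwalk_arcs (xs @ ys))"
    "set (vwalk_arcs ys) \<subseteq> set (vwalk_arcs (xs @ ys))" for xs ys :: "'a list"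
    by (cases "xs = []"; cases "ys = []"; auto simp: vwalk_arcs_append)+
  have "set (vwalk_arcs Q) \<subseteq> set (vwalk_arcs P)"
    using app(1)[of Q ?B] app(2)[of "Q @ ?B" ?A] P by auto
  moreover have "set Q \<subseteq> set P" "distinct Q"
    using assms(1) unfolding Q_def vpath_def
    by (auto dest: in_set_takeD in_set_dropD)
  ultimately have "vpath Q (with_proj G)"
    using assms(1) ne by (auto simp: vpath_def vwalk_def)
  moreover have "hd Q = P ! a" "last Q = P ! b"
    using len ne assms by (auto simp: hd_conv_nth last_conv_nth)
  ultimately show "path_betw G (P ! a) Q (P ! b)" by (simp add: path_betw_def)
  have "set Q = (!) Q ` {0..<length Q}" by (auto simp: set_conv_nth)
  also have "\<dots> = (!) P ` ((+) a ` {0..<length Q})"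
    unfolding image_image using assms len by (intro image_cong) auto
  also have "(+) a ` {0..<length Q} = {a..b}"
    using len assms(2) by (auto simp: image_add_atLeastLessThan)
  finally show "set Q = (!) P ` {a..b}" .
qed

lemma subpath_end:
  assumes "vpath P (with_proj G)" "a \<le> b" "b < length P"
  shows "P ! b \<in> path_ends G (b - a) (P ! a)"
  using subpath(1,2)[OF assms] by (auto simp: path_ends_def)

lemma subpath_start:
  assumes "pair_graph G" "vpath P (with_proj G)" "a \<le> b" "b < length P"
  shows "P ! a \<in> path_ends G (b - a) (P ! b)"
  using subpath_end[OF assms(2-)] path_ends_commute[OF assms(1)] by blast

text \<open>The segment from \<open>a\<close> to \<open>b\<close>, reversed if its least vertex is
  the left end, is the witness. Taking \<open>i\<close> and \<open>j\<close> as its two ends in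
  either order serves both directions; \<open>ij\<close> makes them opposite ends unless the segment
  is a single vertex.\<close>

lemma subpath_wreach:
  assumes G: "pair_graph G" and P: "vpath P (with_proj G)" "a \<le> b" "b < length P" "b - a \<le> q"
    and i: "i \<in> {a, b}" "j \<in> {a, b}"
    and min: "\<And>t. a \<le> t \<Longrightarrow> t \<le> b \<Longrightarrow> (P ! i, P ! t) \<in> \<sigma>"
    and ij: "i = j \<longrightarrow> a = b"
  shows "P ! i \<in> wreach_set G \<sigma> q (P ! j)"
proof -
  define Q where "Q = take (Suc (b - a)) (drop a P)"
  note Q = subpath[OF P(1-3), folded Q_def]
  have "\<exists>R. path_betw G (P ! j) R (P ! i) \<and> length R = length Q \<and> set R = set Q"
  proof (cases "i = b")
    case True
    then have "j = a" using i ij by auto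
    then show ?thesis using True Q(1) by blast
  next
    case False
    then have "i = a" "j = b" using i ij P(2) by auto
    then show ?thesis using path_betw_rev[OF G Q(1)] by (intro exI[of _ "rev Q"]) simp
  qed
  then obtain R where R: "path_betw G (P ! j) R (P ! i)" "length R = length Q" "set R = set Q"
    by blast
  have "set R \<subseteq> right_closed \<sigma> (P ! i)"
    using R(3) Q(3) min by (auto simp: right_closed_def)
  moreover have "P ! i \<in> left_closed \<sigma> (P ! j)"
    using min[of j] i P(2) by (auto simp: left_closed_def)
  ultimately show ?thesis
    using R Q(2) P(4)
    by (auto simp: wreach_set_def weakly_reachable_def intro!: exI[of _ R])
qed

lemma finite_linear_order_least:
  assumes "linear_order_on V \<sigma>" "finite A" "A \<noteq> {}" "A \<subseteq> V"
  shows "\<exists>z\<in>A. \<forall>v\<in>A. (z, v) \<in> \<sigma>"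
  using assms(2-4)
proof (induction A rule: finite_ne_induct)
  case (singleton x)
  then show ?case
    using assms(1) by (auto simp: linear_order_on_def partial_order_on_def preorder_on_def refl_on_def)
next
  case (insert x F)
  then obtain z where z: "z \<in> F" "\<forall>v\<in>F. (z, v) \<in> \<sigma>" by auto
  have lin: "refl_on V \<sigma>" "trans \<sigma>" "total_on V \<sigma>"
    using assms(1) by (auto simp: linear_order_on_def partial_order_on_def preorder_on_def)
  have refl: "(x, x) \<in> \<sigma>" using lin(1) insert.prems by (auto simp: refl_on_def)
  have "x \<in> V" "z \<in> V" using z insert.prems by auto
  then consider "(x, z) \<in> \<sigma>" | "(z, x) \<in> \<sigma>"
    using lin(3) refl by (cases "x = z") (auto simp: total_on_def)
  then show ?case
  proof cases
    case 1
    then have "\<forall>v\<in>insert x F. (x, v) \<in> \<sigma>" using z(2) lin(2) refl by (auto dest: transD)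
    then show ?thesis by auto
  next
    case 2
    then show ?thesis using z by auto
  qed
qed

section \<open>Covering pairs by way of weakly reachable vertices\<close>

definition via_wreach :: "'a pair_pre_digraph \<Rightarrow> 'a rel \<Rightarrow> nat \<Rightarrow> nat \<Rightarrow> nat \<Rightarrow> 'a \<Rightarrow> 'a set" where
  "via_wreach G \<sigma> q a b u = (\<Union>w\<in>path_ends G a u. \<Union>z\<in>wreach_set G \<sigma> q w. path_ends G b z)"

lemma via_wreachI:
  "w \<in> path_ends G a u \<Longrightarrow> z \<in> wreach_set G \<sigma> q w \<Longrightarrow> v \<in> path_ends G b z \<Longrightarrow>
    v \<in> via_wreach G \<sigma> q a b u"
  by (auto simp: via_wreach_def)

text \<open>The jump from \<open>w\<close> to \<open>z\<close> costs only a factor \<open>c\<close>,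
  although it may span up to \<open>q\<close> edges. Only the \<open>a + b\<close> remaining steps,
  later \<open>r\<close> in total, are paid for with the degree.\<close>

lemma card_via_wreach:
  assumes "pair_graph G" "max_degree G \<le> \<Delta>"
    and "\<And>x. x \<in> pverts G \<Longrightarrow> card (wreach_set G \<sigma> q x) \<le> c"
  shows "card (via_wreach G \<sigma> q a b u) \<le> path_count \<Delta> a * (c * path_count \<Delta> b)"
proof -
  interpret pair_graph G by fact
  have fin: "finite (path_ends G a u)" "finite (wreach_set G \<sigma> q w)" for w
    using path_ends_subset wreach_set_subset pair_finite_verts by (metis finite_subset)+
  have c: "card (wreach_set G \<sigma> q w) \<le> c" if "w \<in> path_ends G a u" for w
    using assms(3) that path_ends_subset[of G a u] by blast
  show ?thesis
    unfolding via_wreach_def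
    by (intro card_UN_bounded card_path_ends[OF assms(1,2)] fin c)
qed

text \<open>The first disjunct arises when the least vertex is at position \<open>i\<close>, the
  second when \<open>i\<close> is the position of the vertex \<open>w\<close> from which the least
  vertex is reached. Since \<open>i < q \<le> r + 1\<close>, the subtraction \<open>r - i\<close> is
  never truncated.\<close>

lemma path_covered:
  assumes G: "pair_graph G" and \<sigma>: "linear_order_on (pverts G) \<sigma>"
    and P: "path_betw G x P y" and L: "length P = Suc L" "L \<le> p" "p div 2 \<le> L"
    and p: "p > 0"
  defines "q \<equiv> (p + 1) div 2" and "r \<equiv> p div 2"
  shows "\<exists>i<q. x \<in> via_wreach G \<sigma> q (r - i) i y \<or> y \<in> via_wreach G \<sigma> q i (r - i) x"
proof -
  have pqr: "p = q + r" "r \<le> q" "q \<le> Suc r" "q > 0" using p by (auto simp: q_def r_def)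
  have vp: "vpath P (with_proj G)" using P by (simp add: path_betw_def)
  have ne: "P \<noteq> []" using L by auto
  have ends: "P ! 0 = x" "P ! L = y"
    using P ne L by (auto simp: path_betw_def hd_conv_nth last_conv_nth)
  \<comment> \<open>For even \<open>p\<close> the last vertex is left out, so that the least vertex has \<open>2 * q\<close> possible positions.\<close>
  define m where "m = L + 2 * q - p"
  have m: "0 < m" "m \<le> Suc L" using pqr L p unfolding m_def r_def by linarith+
  have "(!) P ` {..<m} \<subseteq> pverts G"
    using vp m L by (force simp: vpath_def vwalk_def)
  then obtain i where i: "i < m" and min: "\<And>t. t < m \<Longrightarrow> (P ! i, P ! t) \<in> \<sigma>"
    using finite_linear_order_least[OF \<sigma>, of "(!) P ` {..<m}"] m(1) by auto
  have rL: "r \<le> L" using L by (simp add: r_def)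
  show ?thesis
  proof (cases "i < q")
    case True
    \<comment> \<open>The segment from \<open>i\<close> to \<open>b\<close> has
      \<open>L - r \<le> p - r = q\<close> edges. For even \<open>p\<close>,
      \<open>i < q = r\<close> gives \<open>b < L = m\<close>, so the segment avoids the vertex left
      out.\<close>
    define b where "b = L - (r - i)"
    have b: "i \<le> b" "b < m" "b - i \<le> q" "L - b = r - i" "b \<le> L"
      using True pqr rL L(2) i m unfolding b_def m_def by linarith+
    have "P ! b \<in> path_ends G (r - i) y"
      using subpath_start[OF G vp, of b L] b L ends by simp
    moreover have "P ! i \<in> wreach_set G \<sigma> q (P ! b)"
      using b L by (intro subpath_wreach[OF G vp, of i b]) (auto intro!: min)
    moreover have "x \<in> path_ends G i (P ! i)"
      using subpath_start[OF G vp, of 0 i] b L ends by simp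
    ultimately show ?thesis using True by (blast intro: via_wreachI)
  next
    case False
    \<comment> \<open>Mirror image: again the segment from \<open>a\<close> to \<open>i\<close> has
      \<open>L - r \<le> q\<close> edges. For even \<open>p\<close> the bound
      \<open>a < q = r\<close> holds because \<open>i < m = L\<close> forces
      \<open>j \<ge> 1\<close>.\<close>
    define j where "j = L - i"
    define a where "a = r - j"
    have a: "a \<le> i" "i - a \<le> q" "i \<le> L" "L - i = r - a" "a < q"
      using False pqr rL L(2) i m unfolding a_def j_def m_def by linarith+
    have "P ! a \<in> path_ends G a x"
      using subpath_end[OF vp, of 0 a] a L ends by simp
    moreover have "P ! i \<in> wreach_set G \<sigma> q (P ! a)"
      using a i L by (intro subpath_wreach[OF G vp, of a i]) (auto intro!: min)
    moreover have "y \<in> path_ends G (r - a) (P ! i)"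
      using subpath_end[OF vp, of i L] a L ends by simp
    ultimately show ?thesis using a(5) by (blast intro: via_wreachI)
  qed
qed

section \<open>Counting the arcs of the power inside a vertex set\<close>

lemma gdist_le_path:
  assumes "gdist G x y \<le> enat p"
  obtains P where "path_betw G x P y" "length P \<le> Suc p"
proof -
  \<comment> \<open>A strict bound on the infimum yields a path below the bound and rules out the
    value \<open>\<infinity>\<close> of the empty infimum.\<close>
  have "gdist G x y < enat (Suc p)"
    using assms by (rule order_le_less_trans) simp
  then show ?thesis
    using that by (force simp: gdist_def INF_less_iff)
qed

text \<open>Each arc \<open>(x, y)\<close> is charged to an end in \<open>S\<close>: to
  \<open>x\<close> by \<open>near\<close> and \<open>fw\<close>, to \<open>y\<close> by
  \<open>bw\<close>, hence the converse of \<open>Sigma S bw\<close>. The connecting path runs in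
  \<open>G\<close> and may leave \<open>S\<close>, yet the bound stays linear in
  \<open>card S\<close>.\<close>

lemma card_arcs_gpower_le:
  assumes G: "pair_graph G" and deg: "max_degree G \<le> \<Delta>" and p: "p > 0"
    and \<sigma>: "linear_order_on (pverts G) \<sigma>"
    and S: "S \<subseteq> pverts G" and A: "A \<subseteq> parcs (gpower G p)" "A \<subseteq> S \<times> S"
  defines "q \<equiv> (p + 1) div 2" and "r \<equiv> p div 2"
  assumes c: "\<And>x. x \<in> pverts G \<Longrightarrow> card (wreach_set G \<sigma> q x) \<le> c"
  shows "card A \<le> card S *
    ((\<Sum>k<r. path_count \<Delta> k) + 2 * (\<Sum>i<q. path_count \<Delta> i * path_count \<Delta> (r - i)) * c)"
proof -
  interpret pair_graph G by fact
  define near where "near u = (\<Union>k<r. path_ends G k u)" for u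
  define fw where "fw u = (\<Union>i<q. via_wreach G \<sigma> q i (r - i) u)" for u
  define bw where "bw u = (\<Union>i<q. via_wreach G \<sigma> q (r - i) i u)" for u
  let ?T = "(\<Sum>i<q. path_count \<Delta> i * path_count \<Delta> (r - i)) * c"
  have finS: "finite S" using S pair_finite_verts finite_subset by blast
  have sub: "near u \<subseteq> pverts G" "fw u \<subseteq> pverts G" "bw u \<subseteq> pverts G" for u
    using path_ends_subset[of G] by (auto simp: near_def fw_def bw_def via_wreach_def)
  have fin: "finite (near u)" "finite (fw u)" "finite (bw u)" for u
    using sub pair_finite_verts finite_subset by metis+
  have near: "card (near u) \<le> (\<Sum>k<r. path_count \<Delta> k)" for u
    unfolding near_def
    by (rule order_trans[OF card_UN_le]) (auto intro!: sum_mono card_path_ends G deg)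
  have fw: "card (fw u) \<le> ?T" for u
    unfolding fw_def sum_distrib_right
    using card_via_wreach[OF G deg c]
    by (intro order_trans[OF card_UN_le] sum_mono) (auto simp: mult_ac)
  have bw: "card (bw u) \<le> ?T" for u
    unfolding bw_def sum_distrib_right
  proof (intro order_trans[OF card_UN_le] sum_mono)
    show "card (via_wreach G \<sigma> q (r - i) i u) \<le> path_count \<Delta> i * path_count \<Delta> (r - i) * c" for i
      using card_via_wreach[OF G deg c, of "r - i" i u] by (simp add: mult_ac)
  qed simp
  have "A \<subseteq> Sigma S near \<union> Sigma S fw \<union> (Sigma S bw)\<inverse>"
  proof
    fix e assume e: "e \<in> A"
    obtain x y where xy: "e = (x, y)" by (cases e)
    then have S': "x \<in> S" "y \<in> S" and "gdist G x y \<le> enat p"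
      using e A by (auto simp: gpower_def)
    then obtain P where P: "path_betw G x P y" "length P \<le> Suc p"
      by (auto elim: gdist_le_path)
    define L where "L = length P - 1"
    have L: "length P = Suc L"
      using P(1) by (cases P) (auto simp: L_def path_betw_def vpath_def vwalk_def)
    show "e \<in> Sigma S near \<union> Sigma S fw \<union> (Sigma S bw)\<inverse>"
    proof (cases "L < r")
      case True
      then have "y \<in> near x" using P(1) L by (auto simp: near_def path_ends_def)
      then show ?thesis using S' xy by auto
    next
      case False
      then show ?thesis
        using path_covered[OF G \<sigma> P(1) L _ _ p] P(2) L S' xy
        by (auto simp: fw_def bw_def q_def r_def)
    qed
  qed
  then have "card A \<le> card (Sigma S near \<union> Sigma S fw \<union> (Sigma S bw)\<inverse>)"
    using finS fin by (intro card_mono) auto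
  also have "\<dots> \<le> card (Sigma S near) + card (Sigma S fw) + card (Sigma S bw)"
    using card_Un_le[of "Sigma S near \<union> Sigma S fw" "(Sigma S bw)\<inverse>"]
      card_Un_le[of "Sigma S near" "Sigma S fw"] by (simp add: card_inverse)
  also have "\<dots> \<le> card S * (\<Sum>k<r. path_count \<Delta> k) + card S * ?T + card S * ?T"
    by (intro add_mono card_Sigma_bounded finS order_refl fin near fw bw)
  finally show ?thesis by (simp add: algebra_simps)
qed

section \<open>Numerical estimates\<close>

lemma sum_path_count:
  assumes "\<Delta> \<ge> 3"
  shows "(real \<Delta> - 2) * (\<Sum>k\<le>r. real (path_count \<Delta> k)) + 2 = real \<Delta> * (real \<Delta> - 1) ^ r"
proof (induction r)
  case 0
  then show ?case by (simp add: path_count_def)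
next
  case (Suc r)
  have "real (path_count \<Delta> (Suc r)) = real \<Delta> * (real \<Delta> - 1) ^ r"
    using assms by (simp add: path_count_def of_nat_diff)
  then show ?case using Suc by (simp add: algebra_simps)
qed

text \<open>Put \<open>D = \<Delta> - 1\<close>. If both lengths are positive, the product is
  \<open>(D + 1)^2 * D^(r - 2)\<close>, and the claim reduces to
  \<open>(D - 1) * (D + 1) \<le> D^2\<close>. If one length is zero, the product is the single value
  \<open>path_count \<Delta> r\<close>, and \<open>D - 1 \<le> D\<close> suffices for
  \<open>r > 0\<close>.\<close>

lemma path_count_mult_le:
  assumes "\<Delta> \<ge> 3" "i \<le> r"
  shows "real (path_count \<Delta> i) * real (path_count \<Delta> (r - i))
    \<le> real \<Delta> / (real \<Delta> - 2) * (real \<Delta> - 1) ^ r"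
proof -
  define D where "D = real \<Delta> - 1"
  have D: "D \<ge> 2" "real \<Delta> = D + 1" "real (\<Delta> - 1) = D" using assms by (auto simp: D_def of_nat_diff)
  have *: "(D - 1) * (real (path_count \<Delta> i) * real (path_count \<Delta> (r - i))) \<le> (D + 1) * D ^ r"
  proof (cases "i = 0 \<or> i = r")
    case True
    then have "real (path_count \<Delta> i) * real (path_count \<Delta> (r - i)) = real (path_count \<Delta> r)"
      by (auto simp: path_count_def)
    moreover have "(D - 1) * real (path_count \<Delta> r) \<le> (D + 1) * D ^ r"
    proof (cases r)
      case 0
      then show ?thesis by (simp add: path_count_def)
    next
      case (Suc n)
      have "(D - 1) * ((D + 1) * D ^ n) \<le> D * ((D + 1) * D ^ n)"
        using D by (intro mult_right_mono) auto
      then show ?thesis using Suc D by (simp add: path_count_def algebra_simps)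
    qed
    ultimately show ?thesis by simp
  next
    case False
    define n where "n = r - 2"
    have "i - 1 + (r - i - 1) = n" "r = n + 2" using False assms by (auto simp: n_def)
    then have "real (path_count \<Delta> i) * real (path_count \<Delta> (r - i)) = (D + 1) * (D + 1) * D ^ n"
      using False assms(2) D by (simp add: path_count_def power_add[symmetric])
    moreover have "(D + 1) * D ^ n * ((D - 1) * (D + 1)) \<le> (D + 1) * D ^ n * D\<^sup>2"
      using D by (intro mult_left_mono) (auto simp: power2_eq_square algebra_simps)
    ultimately show ?thesis using \<open>r = n + 2\<close> by (simp add: power2_eq_square mult_ac)
  qed
  have "real \<Delta> - 2 = D - 1" using D by simp
  with * D show ?thesis by (simp add: field_simps)
qed

text \<open>Bounding every summand by \<open>K\<close> would spend the whole right-hand side on the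
  second sum. The summand for \<open>i = 0\<close> is just a sphere, and the first sum completes it
  to a ball, which is still at most \<open>K\<close>.\<close>

lemma count_bound:
  assumes "\<Delta> \<ge> 3" "q > 0" "q \<le> Suc r" "c > 0"
  shows "real ((\<Sum>k<r. path_count \<Delta> k)
      + 2 * (\<Sum>i<q. path_count \<Delta> i * path_count \<Delta> (r - i)) * c)
    \<le> real \<Delta> / (real \<Delta> - 2) * (2 * real q) * real c * (real \<Delta> - 1) ^ r"
proof -
  define K where "K = real \<Delta> / (real \<Delta> - 2) * (real \<Delta> - 1) ^ r"
  define s where "s i = real (path_count \<Delta> i) * real (path_count \<Delta> (r - i))" for i
  let ?N = "\<Sum>k<r. real (path_count \<Delta> k)"
  have s0: "s 0 = real (path_count \<Delta> r)" by (simp add: s_def path_count_def)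
  \<comment> \<open>\<open>?N + s 0\<close> is the size of the ball of radius \<open>r\<close> in
    the \<open>\<Delta>\<close>-regular tree, a geometric sum.\<close>
  have "(real \<Delta> - 2) * (?N + s 0) \<le> real \<Delta> * (real \<Delta> - 1) ^ r"
    using sum_path_count[OF assms(1), of r] s0 by (simp add: lessThan_Suc_atMost[symmetric])
  then have 0: "?N + s 0 \<le> K" using assms(1) by (simp add: K_def field_simps)
  have "sum s {1..<q} \<le> of_nat (card {1..<q}) * K"
    using path_count_mult_le[OF assms(1), of _ r] assms(3)
    by (intro sum_bounded_above) (auto simp: s_def K_def)
  then have 1: "sum s {1..<q} \<le> (real q - 1) * K" using assms(2) by (simp add: of_nat_diff)
  have "{..<q} = insert 0 {1..<q}" using assms(2) by auto
  then have sq: "sum s {..<q} = s 0 + sum s {1..<q}" by simp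
  have N: "0 \<le> ?N" by (simp add: sum_nonneg)
  \<comment> \<open>Positivity of \<open>c\<close> lets \<open>?N\<close> be raised to the factor
    \<open>2 * c\<close> of the other terms, so that it can be merged with
    \<open>s 0\<close>.\<close>
  then have "?N \<le> 2 * real c * ?N" using assms(4) mult_right_mono[of 1 "2 * real c" ?N] by simp
  then have "?N + 2 * sum s {..<q} * real c \<le> 2 * real c * (?N + s 0 + sum s {1..<q})"
    by (simp add: sq algebra_simps)
  also have "\<dots> \<le> 2 * real c * (K + (real q - 1) * K)"
    using 0 1 by (intro mult_left_mono add_mono) auto
  also have "\<dots> = real \<Delta> / (real \<Delta> - 2) * (2 * real q) * real c * (real \<Delta> - 1) ^ r"
    unfolding K_def by algebra
  finally show ?thesis by (simp add: s_def)
qed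

section \<open>Edges, the optimal ordering and the final bound\<close>

lemma card_uedges:
  assumes "pair_graph H"
  shows "2 * card (uedges H) \<le> card (parcs H)"
proof -
  interpret pair_graph H by fact
  define f where "f e = {fst e, snd e}" for e :: "'a \<times> 'a"
  have U: "uedges H = f ` parcs H" by (force simp: uedges_def f_def)
  \<comment> \<open>Forgetting the direction maps both orientations to the same edge; they are
    distinct arcs because there are no loops.\<close>
  have two: "2 \<le> card {e \<in> parcs H. f e = u}" if "u \<in> uedges H" for u
  proof -
    obtain x y where xy: "u = {x, y}" "(x, y) \<in> parcs H" using \<open>u \<in> _\<close> by (auto simp: uedges_def)
    then have "(y, x) \<in> parcs H" "x \<noteq> y"
      using sym_arcs pair_no_loops by (fastforce simp: symmetric_def sym_def)+
    then have "card {(x, y), (y, x)} = 2" "{(x, y), (y, x)} \<subseteq> {e \<in> parcs H. f e = u}"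
      using xy by (auto simp: f_def)
    then show ?thesis
      using card_mono[of "{e \<in> parcs H. f e = u}" "{(x, y), (y, x)}"] by simp
  qed
  have "card (uedges H) * 2 \<le> (\<Sum>u\<in>uedges H. card {e \<in> parcs H. f e = u})"
    using sum_bounded_below[of "uedges H" "2::nat" "\<lambda>u. card {e \<in> parcs H. f e = u}"] two by simp
  also have "\<dots> = card (parcs H)"
    using sum.image_gen[of "parcs H" "\<lambda>_. 1::nat" f] by (simp add: U)
  finally show ?thesis by simp
qed

lemma wcol_attained:
  assumes "pair_graph G" "pverts G \<noteq> {}"
  obtains \<sigma> where "linear_order_on (pverts G) \<sigma>"
    and "\<And>x. x \<in> pverts G \<Longrightarrow> card (wreach_set G \<sigma> k x) \<le> wcol k G"
proof -
  interpret pair_graph G by fact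
  let ?O = "{\<sigma>. linear_order_on (pverts G) \<sigma>}"
  let ?f = "\<lambda>\<sigma>. MAX x\<in>pverts G. card (wreach_set G \<sigma> k x)"
  have "Min (?f ` ?O) \<in> ?f ` ?O"
    using finite_linear_orders[OF pair_finite_verts] linear_orders_nonempty by (intro Min_in) auto
  then obtain \<sigma> where \<sigma>: "linear_order_on (pverts G) \<sigma>" "wcol k G = ?f \<sigma>"
    using assms(2) by (auto simp: wcol_def)
  show ?thesis by (rule that[OF \<sigma>(1)]) (auto simp: \<sigma>(2) intro!: Max_ge)
qed

text \<open>The one-vertex path is the witness. This makes the weak coloring number of a nonempty
  graph positive, as \<open>count_bound\<close> assumes.\<close>

lemma wreach_set_self:
  assumes "x \<in> pverts G"
  shows "x \<in> wreach_set G \<sigma> k x"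
  using assms by (auto simp: wreach_set_def weakly_reachable_def left_closed_def right_closed_def
      path_betw_def vpath_def vwalk_def intro!: exI[of _ "[x]"])

theorem theorem2p3:
  fixes G :: "'a pair_pre_digraph" and p \<Delta> :: nat
  assumes "p > 0"
    and "\<Delta> \<ge> 3"
    and "pair_graph G"
    and "max_degree G \<le> \<Delta>"
  shows "mad (gpower G p) \<le>
    real \<Delta> / (real \<Delta> - 2) * (2 * real ((p + 1) div 2)) *
    real (wcol (nat \<lceil>real p / 2\<rceil>) G) * (real \<Delta> - 1) ^ (p div 2)"
proof (cases "pverts G = {}")
  case True
  \<comment> \<open>By the conventions for the graph without vertices, \<open>mad\<close> and
    \<open>wcol\<close> are both 0, so the claim reads \<open>0 \<le> 0\<close>.\<close>
  then show ?thesis by (simp add: mad_def gpower_def wcol_def)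
next
  case False
  interpret pair_graph G by fact
  define q where "q = (p + 1) div 2"
  define r where "r = p div 2"
  have qr: "q > 0" "q \<le> Suc r" using assms(1) by (auto simp: q_def r_def)
  \<comment> \<open>The radius of the weak coloring number and the rounded factor in the bound are
    the same number \<open>q\<close>.\<close>
  have q: "nat \<lceil>real p / 2\<rceil> = q"
    unfolding q_def using div_mult_mod_eq[of "p + 1" 2] by linarith
  define c where "c = wcol q G"
  obtain \<sigma> where \<sigma>: "linear_order_on (pverts G) \<sigma>"
    and c: "\<And>x. x \<in> pverts G \<Longrightarrow> card (wreach_set G \<sigma> q x) \<le> c"
    using wcol_attained[OF assms(3) False] unfolding c_def by metis
  obtain x where x: "x \<in> pverts G" using False by auto
  have "card (wreach_set G \<sigma> q x) > 0"
    using wreach_set_self[OF x, of \<sigma> q] finite_subset[OF wreach_set_subset pair_finite_verts]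
    by (metis card_gt_0_iff empty_iff)
  then have c0: "c > 0" using c[OF x] by simp
  let ?M = "real \<Delta> / (real \<Delta> - 2) * (2 * real q) * real c * (real \<Delta> - 1) ^ r"
  have gp: "pair_graph (gpower G p)" using assms(3) by (rule pair_graph_gpower)
  have ne: "pverts (gpower G p) \<noteq> {}" using False by (simp add: gpower_def)
  have "2 * real (card (uedges H)) / real (card (pverts H)) \<le> ?M"
    if H: "H \<in> nonempty_subgraphs (gpower G p)" for H
  proof -
    have pg: "pair_graph H" and sub: "parcs H \<subseteq> parcs (gpower G p)" "pverts H \<subseteq> pverts G"
      and neH: "pverts H \<noteq> {}"
      using H by (auto simp: nonempty_subgraphs_def subgraph_def gpower_def)
    interpret H: pair_graph H by fact
    have "parcs H \<subseteq> pverts H \<times> pverts H"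
      using H.in_arcsD1 H.in_arcsD2 by auto
    then have "card (parcs H) \<le> card (pverts H) * ((\<Sum>k<r. path_count \<Delta> k)
        + 2 * (\<Sum>i<q. path_count \<Delta> i * path_count \<Delta> (r - i)) * c)"
      unfolding q_def r_def
      by (intro card_arcs_gpower_le[OF assms(3,4,1) \<sigma> sub(2,1)]) (use c in \<open>auto simp: q_def\<close>)
    with card_uedges[OF pg] have "real (2 * card (uedges H)) \<le> real (card (pverts H) *
        ((\<Sum>k<r. path_count \<Delta> k) + 2 * (\<Sum>i<q. path_count \<Delta> i * path_count \<Delta> (r - i)) * c))"
      by (subst of_nat_le_iff) linarith
    also have "\<dots> \<le> real (card (pverts H)) * ?M"
      unfolding of_nat_mult[of "card _"]
      by (intro mult_left_mono count_bound[OF assms(2) qr c0]) auto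
    finally show ?thesis
      using neH H.pair_finite_verts
      by (simp add: divide_le_eq card_gt_0_iff mult.commute)
  qed
  then have "mad (gpower G p) \<le> ?M"
    unfolding mad_def if_not_P[OF ne]
    using finite_nonempty_subgraphs[OF gp] nonempty_subgraphs_self[OF gp ne]
    by (intro Max.boundedI) auto
  then show ?thesis by (simp add: q c_def q_def r_def)
qed

end
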